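(* Let $G$ be an undirected loopless quantum graph with adjacency operator $A_G$ and let $k$ be a positive integer. Then the following are equivalent. 1. $G$ admits a decomposition into $k$ connected components: there exists a partition of $V(G)$ into projective subsets $P_1,\dots,P_k\sqsubseteq V(G)$ such that $E(G)$ and $P_s\times P_t$ are disjoint for all $s\neq t\in\{1,\dots,k\}$. 2. $G$ admits a CGW decomposition into $k$ connected components: there exist non-trivial projections $p_1,\dots,p_k\in V(G)$ with $\sum_i p_i=1$ such that $L_{p_s}A_GL_{p_t}=0$ for all $s\neq t\in\{1,\dots,k\}$, where $L_a$ denotes left multiplication by $a$ on $V(G)$.
   Context: All Hilbert spaces are finite-dimensional; "projector" means orthogonal projector. A projection in a C*-algebra is an element $p$ with $p^2=p^*=p$; it is non-trivial if $p\neq 0$ and $p\neq 1$. Quantum sets. A quantum set is a special symmetric $\dagger$-Frobenius monoid in finite-dimensional Hilbert spaces; equivalently a finite-dimensional C*-algebra, up to isomorphism $X=\bigoplus_{i=1}^r M_{n_i}$ with the usual product, unit $1$ and involution, and inner product $\langle a,b\rangle=\sum_i n_i\mathrm{Tr}(a_i^*b_i)$, for which the multiplication $m:X\otimes X\to X$ satisfies $mm^\dagger=\mathrm{id}_X$. It acts block-diagonally on $H=\bigoplus_i\mathbb{C}^{n_i}$, so $X\subseteq B(H)$. Projective subsets. A projective subset $Y\sqsubseteq X$ is given by a projector $\widehat Y:X\to X$ with $\widehat Y(ab)=\widehat Y(a)b$ for all $a,b\in X$. These correspond bijectively to projections $\widetilde Y=\widehat Y(1)\in X$, via $\widehat Y(a)=\widetilde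 Ya$; $\widetilde Y$ is also viewed as a projector on $H$. The union $Y\cup Z$ has as its projection the projector onto $\mathrm{span}(\mathrm{img}\,\widetilde Y\cup\mathrm{img}\,\widetilde Z)$. $Y,Z\sqsubseteq X$ are disjoint if $\mathrm{img}\,\widetilde Y\perp\mathrm{img}\,\widetilde Z$. A partition of $X$ is a collection of mutually disjoint projective subsets $P_1,\dots,P_k\sqsubseteq X$ with $\bigcup_sP_s=X$ (the projective subset with projection $1$). Cartesian products. For a quantum set $V\subseteq B(H)$, the quantum set $V^{op}\otimes V$ acts on $H^*\otimes H\cong B(H)$ (identify $\langle u|\otimes|v\rangle$ with $|v\rangle\langle u|$) by $(a\otimes b)\cdot x=bxa$; thus projections in $V^{op}\otimes V$ have images in $B(H)$, which carries the Hilbert–Schmidt inner product, and disjointness of projective subsets of $V^{op}\otimes V$ means orthogonality of these images. For $Y,Z\sqsubseteq V$, $Y\times Z\sqsubseteq V^{op}\otimes V$ is the projective subset whose projection acts on $B(H)$ as $x\mapsto\widetilde Zx\widetilde Y$. Quantum graphs. A quantum graph $G$ is a quantum set $V=V(G)$ with a linear map $A_G:V\to V$, the adjacency operator, satisfying $m(A_G\otimes A_G)m^\dagger=A_G$ and $A_G(x^* )=A_G(x)^*$. Equivalently, it is given by its edge relation $E(G)\sqsubseteq V^{op}\otimes V$, i.e. a projector $\widehat{E(G)}$ on $V\otimes V$ with $\widehat{E(G)}(ax\otimes yb)=(a\otimes 1)\widehat{E(G)}(x\otimes y)(1\otimes b)$, related to $A_G$ by $\widehat{E(G)}=(\mathrm{id}\otimes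 m)(\mathrm{id}\otimes A_G\otimes\mathrm{id})(m^\dagger\otimes\mathrm{id})$. $G$ is undirected if $A_G=A_G^\dagger$ and loopless if $m(A_G\otimes\mathrm{id})m^\dagger=0$.
   Formalization: In condition 1 the parts P_s are also required to be non-trivial (projection neither 0 nor 1); otherwise P_1 = V(G) with all other parts empty would satisfy condition 1 for every G and k, making the equivalence false. For k = 1 neither decomposition then exists. *)

theory Defs
  imports "HOL-Analysis.Analysis"
begin

section \<open>Complex matrices\<close>

definition dagger :: "complex^'n^'m \<Rightarrow> complex^'m^'n" where
  "dagger a = (\<chi> i j. cnj (a $ j $ i))"

definition mscale :: "complex \<Rightarrow> complex^'n^'m \<Rightarrow> complex^'n^'m" where
  "mscale c a = (\<chi> i j. c * a $ i $ j)"

definition cdot :: "complex^'n \<Rightarrow> complex^'n \<Rightarrow> complex" where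
  "cdot u v = (\<Sum>i\<in>UNIV. cnj (u $ i) * v $ i)"

definition hs_inner :: "complex^'n^'n \<Rightarrow> complex^'n^'n \<Rightarrow> complex" where
  "hs_inner x y = trace (dagger x ** y)"

definition img :: "complex^'n^'n \<Rightarrow> (complex^'n) set" where
  "img p = range (\<lambda>u. p *v u)"

definition is_projection :: "complex^'n^'n \<Rightarrow> bool" where
  "is_projection p \<longleftrightarrow> p ** p = p \<and> dagger p = p"

definition nontrivial :: "complex^'n^'n \<Rightarrow> bool" where
  "nontrivial p \<longleftrightarrow> p \<noteq> 0 \<and> p \<noteq> mat 1"

definition projector_onto :: "(complex^'n) set \<Rightarrow> complex^'n^'n" where
  "projector_onto S = (THE p. is_projection p \<and> img p = S)"

definition mat_unit :: "'m \<Rightarrow> 'n \<Rightarrow> complex^'n^'m" where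
  "mat_unit i j = (\<chi> k l. if k = i \<and> l = j then 1 else 0)"


section \<open>Quantum sets\<close>

text \<open>
  The quantum set with block labelling \<open>\<beta>\<close> is the direct sum of full matrix algebras,
  one for each value \<open>c\<close> of \<open>\<beta>\<close>, of size \<open>card (\<beta> -` {c})\<close>. It is realised as the algebra of
  block-diagonal matrices on the space \<open>H\<close> with basis indexed by \<open>'n\<close>, the basis vectors in one
  fibre of \<open>\<beta>\<close> spanning one block. Product, unit and involution are \<open>**\<close>, \<open>mat 1\<close> and \<open>dagger\<close>.
\<close>

definition qset :: "('n \<Rightarrow> 'b) \<Rightarrow> (complex^'n^'n) set" where
  "qset \<beta> = {a. \<forall>i j. \<beta> i \<noteq> \<beta> j \<longrightarrow> a $ i $ j = 0}"

text \<open>The sum over the fibre of \<open>c\<close> is the trace of the block \<open>c\<close> of \<open>dagger a ** b\<close>.\<close>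

definition qinner :: "('n \<Rightarrow> 'b) \<Rightarrow> complex^'n^'n \<Rightarrow> complex^'n^'n \<Rightarrow> complex" where
  "qinner \<beta> a b =
     (\<Sum>c\<in>range \<beta>. of_nat (card (\<beta> -` {c})) * (\<Sum>i\<in>\<beta> -` {c}. (dagger a ** b) $ i $ i))"

text \<open>
  Maps between quantum sets are functions on the ambient matrix spaces of which only the values
  on the respective quantum sets are meaningful.
\<close>

definition qlinear ::
    "('n \<Rightarrow> 'b) \<Rightarrow> ('m \<Rightarrow> 'c) \<Rightarrow> (complex^'n^'n \<Rightarrow> complex^'m^'m) \<Rightarrow> bool" where
  "qlinear \<beta> \<gamma> f \<longleftrightarrow>
     (\<forall>a\<in>qset \<beta>. f a \<in> qset \<gamma>) \<and>
     (\<forall>a\<in>qset \<beta>. \<forall>b\<in>qset \<beta>. f (a + b) = f a + f b) \<and>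
     (\<forall>c. \<forall>a\<in>qset \<beta>. f (mscale c a) = mscale c (f a))"

definition qadjoint ::
    "('n \<Rightarrow> 'b) \<Rightarrow> ('m \<Rightarrow> 'c) \<Rightarrow> (complex^'n^'n \<Rightarrow> complex^'m^'m) \<Rightarrow>
     complex^'m^'m \<Rightarrow> complex^'n^'n" where
  "qadjoint \<beta> \<gamma> f b =
     (THE a. a \<in> qset \<beta> \<and> (\<forall>x\<in>qset \<beta>. qinner \<beta> x a = qinner \<gamma> (f x) b))"


section \<open>Tensor products\<close>

text \<open>
  Tensors of matrices are Kronecker products, so the tensor product of the quantum sets
  \<open>\<beta>\<close> and \<open>\<gamma>\<close>, with its inner product, is the quantum set \<open>map_prod \<beta> \<gamma>\<close>.
\<close>

definition tensor :: "complex^'n::finite^'n \<Rightarrow> complex^'m::finite^'m \<Rightarrow> complex^('n\<times>'m)^('n\<times>'m)" where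
  "tensor a b = (\<chi> p q. a $ fst p $ fst q * b $ snd p $ snd q)"

text \<open>
  The linear map taking \<open>tensor a b\<close> to \<open>tensor (f a) (g b)\<close>, written out on matrix units. For an
  argument in the quantum set \<open>map_prod \<beta> \<gamma>\<close>, only matrix units in the quantum sets \<open>\<beta>\<close> and
  \<open>\<gamma>\<close> occur with a non-zero coefficient.
\<close>

definition tensor_map ::
    "(complex^'n::finite^'n \<Rightarrow> complex^'k::finite^'k) \<Rightarrow> (complex^'m::finite^'m \<Rightarrow> complex^'l::finite^'l) \<Rightarrow>
     complex^('n\<times>'m)^('n\<times>'m) \<Rightarrow> complex^('k\<times>'l)^('k\<times>'l)" where
  "tensor_map f g T =
     (\<Sum>p\<in>UNIV. \<Sum>q\<in>UNIV.
        mscale (T $ p $ q)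
          (tensor (f (mat_unit (fst p) (fst q))) (g (mat_unit (snd p) (snd q)))))"

definition assoc ::
    "complex^(('n::finite\<times>'m::finite)\<times>'k::finite)^(('n\<times>'m)\<times>'k) \<Rightarrow> complex^('n\<times>('m\<times>'k))^('n\<times>('m\<times>'k))" where
  "assoc T = (\<chi> p q. T $ ((fst p, fst (snd p)), snd (snd p)) $ ((fst q, fst (snd q)), snd (snd q)))"

text \<open>The multiplication \<open>m\<close> as a linear map on the tensor square; see \<open>mult_tensor\<close> below.\<close>

definition mult :: "complex^('n::finite\<times>'n)^('n\<times>'n) \<Rightarrow> complex^'n^'n" where
  "mult T = (\<chi> i j. \<Sum>k\<in>UNIV. T $ (i, k) $ (k, j))"

definition comult :: "('n \<Rightarrow> 'b) \<Rightarrow> complex^'n^'n \<Rightarrow> complex^('n\<times>'n)^('n\<times>'n)" where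
  "comult \<beta> = qadjoint (map_prod \<beta> \<beta>) \<beta> mult"

lemma mult_tensor: "mult (tensor a b) = a ** b"
  by (simp add: mult_def tensor_def matrix_matrix_mult_def vec_eq_iff)


section \<open>Projective subsets\<close>

definition proj_subset :: "('n \<Rightarrow> 'b) \<Rightarrow> (complex^'n^'n \<Rightarrow> complex^'n^'n) \<Rightarrow> bool" where
  "proj_subset \<beta> Y \<longleftrightarrow>
     qlinear \<beta> \<beta> Y \<and>
     (\<forall>a\<in>qset \<beta>. Y (Y a) = Y a) \<and>
     (\<forall>a\<in>qset \<beta>. qadjoint \<beta> \<beta> Y a = Y a) \<and>
     (\<forall>a\<in>qset \<beta>. \<forall>b\<in>qset \<beta>. Y (a ** b) = Y a ** b)"

definition pset_proj :: "(complex^'n^'n \<Rightarrow> complex^'n^'n) \<Rightarrow> complex^'n^'n" where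
  "pset_proj Y = Y (mat 1)"

definition pset_disjoint ::
    "(complex^'n^'n \<Rightarrow> complex^'n^'n) \<Rightarrow> (complex^'n^'n \<Rightarrow> complex^'n^'n) \<Rightarrow> bool" where
  "pset_disjoint Y Z \<longleftrightarrow> (\<forall>u\<in>img (pset_proj Y). \<forall>v\<in>img (pset_proj Z). cdot u v = 0)"

definition pset_Union ::
    "(complex^'n^'n \<Rightarrow> complex^'n^'n) set \<Rightarrow> complex^'n^'n \<Rightarrow> complex^'n^'n" where
  "pset_Union \<P> a = projector_onto (vec.span (\<Union>Y\<in>\<P>. img (pset_proj Y))) ** a"

definition pset_partition ::
    "('n \<Rightarrow> 'b) \<Rightarrow> nat \<Rightarrow> (nat \<Rightarrow> complex^'n^'n \<Rightarrow> complex^'n^'n) \<Rightarrow> bool" where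
  "pset_partition \<beta> k P \<longleftrightarrow>
     (\<forall>s\<in>{1..k}. proj_subset \<beta> (P s)) \<and>
     (\<forall>s\<in>{1..k}. \<forall>t\<in>{1..k}. s \<noteq> t \<longrightarrow> pset_disjoint (P s) (P t)) \<and>
     pset_proj (pset_Union (P ` {1..k})) = mat 1"


section \<open>Projective subsets of the product of the opposite of V with V\<close>

text \<open>
  Elements of the tensor product of \<open>V\<close>-opposite with \<open>V\<close> are the elements of the tensor square
  of \<open>V\<close>; \<open>op_action\<close> is their action on matrices \<open>x\<close>, extending \<open>op_action_tensor\<close> linearly.
\<close>

definition op_action :: "complex^('n::finite\<times>'n)^('n\<times>'n) \<Rightarrow> complex^'n^'n \<Rightarrow> complex^'n^'n" where
  "op_action T x = (\<chi> i j. \<Sum>k\<in>UNIV. \<Sum>l\<in>UNIV. T $ (l, i) $ (j, k) * x $ k $ l)"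

lemma op_action_tensor: "op_action (tensor a b) x = b ** x ** a"
proof -
  have "(\<Sum>k\<in>UNIV. \<Sum>l\<in>UNIV. a $ l $ j * b $ i $ k * x $ k $ l)
        = (\<Sum>l\<in>UNIV. (\<Sum>k\<in>UNIV. b $ i $ k * x $ k $ l) * a $ l $ j)" for i j
    by (subst sum.swap) (simp add: sum_distrib_right sum_distrib_left mult_ac)
  then show ?thesis
    by (simp add: op_action_def tensor_def matrix_matrix_mult_def vec_eq_iff)
qed

definition op_img ::
    "(complex^('n::finite\<times>'n)^('n\<times>'n) \<Rightarrow> complex^('n\<times>'n)^('n\<times>'n)) \<Rightarrow> (complex^'n^'n) set" where
  "op_img E = range (op_action (pset_proj E))"

definition op_disjoint ::
    "(complex^('n::finite\<times>'n)^('n\<times>'n) \<Rightarrow> complex^('n\<times>'n)^('n\<times>'n)) \<Rightarrow>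
     (complex^('n\<times>'n)^('n\<times>'n) \<Rightarrow> complex^('n\<times>'n)^('n\<times>'n)) \<Rightarrow> bool" where
  "op_disjoint E F \<longleftrightarrow> (\<forall>x\<in>op_img E. \<forall>y\<in>op_img F. hs_inner x y = 0)"

text \<open>
  Left multiplication by \<open>tensor (pset_proj Y) (pset_proj Z)\<close> in the tensor product of
  \<open>V\<close>-opposite with \<open>V\<close>: the multiplication in the first factor is reversed.
\<close>

definition pset_times ::
    "(complex^'n^'n \<Rightarrow> complex^'n^'n) \<Rightarrow> (complex^'n^'n \<Rightarrow> complex^'n^'n) \<Rightarrow>
     complex^('n\<times>'n)^('n\<times>'n) \<Rightarrow> complex^('n\<times>'n)^('n\<times>'n)" where
  "pset_times Y Z = tensor_map (\<lambda>x. x ** pset_proj Y) (\<lambda>y. pset_proj Z ** y)"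


section \<open>Quantum graphs\<close>

definition quantum_graph :: "('n \<Rightarrow> 'b) \<Rightarrow> (complex^'n^'n \<Rightarrow> complex^'n^'n) \<Rightarrow> bool" where
  "quantum_graph \<beta> A \<longleftrightarrow>
     qlinear \<beta> \<beta> A \<and>
     (\<forall>x\<in>qset \<beta>. mult (tensor_map A A (comult \<beta> x)) = A x) \<and>
     (\<forall>x\<in>qset \<beta>. A (dagger x) = dagger (A x))"

definition undirected :: "('n \<Rightarrow> 'b) \<Rightarrow> (complex^'n^'n \<Rightarrow> complex^'n^'n) \<Rightarrow> bool" where
  "undirected \<beta> A \<longleftrightarrow> (\<forall>x\<in>qset \<beta>. qadjoint \<beta> \<beta> A x = A x)"

definition loopless :: "('n \<Rightarrow> 'b) \<Rightarrow> (complex^'n^'n \<Rightarrow> complex^'n^'n) \<Rightarrow> bool" where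
  "loopless \<beta> A \<longleftrightarrow> (\<forall>x\<in>qset \<beta>. mult (tensor_map A id (comult \<beta> x)) = 0)"

definition edge_rel ::
    "('n \<Rightarrow> 'b) \<Rightarrow> (complex^'n^'n \<Rightarrow> complex^'n^'n) \<Rightarrow>
     complex^('n\<times>'n)^('n\<times>'n) \<Rightarrow> complex^('n\<times>'n)^('n\<times>'n)" where
  "edge_rel \<beta> A T =
     tensor_map id mult (assoc (tensor_map (tensor_map id A) id (tensor_map (comult \<beta>) id T)))"

text \<open>
  The parts are required to be non-trivial, neither empty nor the whole quantum set, as the
  projections in \<open>cgw_decomposition\<close> are. If empty parts were allowed, every quantum graph would
  have a decomposition into any number \<open>k \<ge> 1\<close> of components. For \<open>k \<ge> 2\<close> non-triviality amounts
  to the parts being non-empty; for \<open>k = 1\<close> neither kind of decomposition exists.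
\<close>

definition component_decomposition ::
    "('n \<Rightarrow> 'b) \<Rightarrow> (complex^'n^'n \<Rightarrow> complex^'n^'n) \<Rightarrow> nat \<Rightarrow> bool" where
  "component_decomposition \<beta> A k \<longleftrightarrow>
     (\<exists>P. pset_partition \<beta> k P \<and>
          (\<forall>s\<in>{1..k}. nontrivial (pset_proj (P s))) \<and>
          (\<forall>s\<in>{1..k}. \<forall>t\<in>{1..k}. s \<noteq> t \<longrightarrow>
             op_disjoint (edge_rel \<beta> A) (pset_times (P s) (P t))))"

definition cgw_decomposition ::
    "('n \<Rightarrow> 'b) \<Rightarrow> (complex^'n^'n \<Rightarrow> complex^'n^'n) \<Rightarrow> nat \<Rightarrow> bool" where
  "cgw_decomposition \<beta> A k \<longleftrightarrow>
     (\<exists>p. (\<forall>s\<in>{1..k}. p s \<in> qset \<beta> \<and> is_projection (p s) \<and> nontrivial (p s)) \<and>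
          (\<Sum>s\<in>{1..k}. p s) = mat 1 \<and>
          (\<forall>s\<in>{1..k}. \<forall>t\<in>{1..k}. s \<noteq> t \<longrightarrow>
             (\<forall>x\<in>qset \<beta>. p s ** A (p t ** x) = 0)))"

end

theory Submission
  imports Defs
begin

text \<open>
  A projective subset of \<open>V\<close> is left multiplication by its projection, so both decompositions amount
  to a family of non-trivial projections \<open>p s\<close> in \<open>V\<close>. Being a partition means that they sum to \<open>1\<close>
  (\<open>pset_partition_iff\<close>): pairwise orthogonal projections sum to the projector onto the span of
  their ranges, and conversely projections with sum \<open>1\<close> are pairwise orthogonal
  (\<open>projections_sum_1_orthogonal\<close>).

  It remains to compare the conditions on the edges for two projective subsets \<open>Y\<close> and \<open>Z\<close> with
  projections \<open>y\<close> and \<open>z\<close> (\<open>edges_disjoint_iff\<close>). Write \<open>e i k\<close> for the matrix units and \<open>n i\<close> for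
  the size of the block of \<open>i\<close>. The comultiplication sends \<open>1\<close> to the sum of
  \<open>(1 / n i) e i k \<otimes> e k i\<close> over all \<open>i\<close>, \<open>k\<close> in a common block. The projection of the edge relation
  arises from it by applying \<open>A\<close> to the second factor (\<open>pset_proj_edge_rel\<close>), so it acts on
  matrices as \<open>E x = (\<Sum>i k. (1 / n i) A (e k i) x (e i k))\<close>. As \<open>x \<mapsto> z x y\<close>, the action of \<open>Y \<times> Z\<close>, is
  self-adjoint for the Hilbert-Schmidt inner product, disjointness says that \<open>z (E x) y = 0\<close> for
  all \<open>x\<close> (\<open>op_disjoint_times_iff\<close>). Now \<open>y\<close> can be moved from one tensor factor to the other:
  \<open>\<Sum>i k. (1 / n i) (e i k y) \<otimes> e k i = \<Sum>i k. (1 / n i) e i k \<otimes> (y e k i)\<close>. Hence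
  \<open>z (E x) y = (\<Sum>i k. (1 / n i) z A (y e k i) x (e i k))\<close>, and this vanishes for all \<open>x\<close> exactly if
  \<open>z A (y a) = 0\<close> for all matrix units \<open>a\<close> of \<open>V\<close>, that is, for all \<open>a\<close> in \<open>V\<close>
  (\<open>compressed_edge_action_eq_0_iff\<close>).
\<close>

section \<open>Matrix algebra\<close>

lemma dagger_mult: "dagger (a ** b) = dagger b ** dagger a"
  by (simp add: dagger_def matrix_matrix_mult_def vec_eq_iff mult.commute)

lemma dagger_sum: "dagger (\<Sum>s\<in>S. f s) = (\<Sum>s\<in>S. dagger (f s))"
  by (simp add: dagger_def vec_eq_iff)

lemma dagger_0 [simp]: "dagger 0 = 0"
  by (simp add: dagger_def vec_eq_iff)

lemma dagger_mat_1 [simp]: "dagger (mat 1) = mat 1"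
  by (auto simp: dagger_def mat_def vec_eq_iff)

lemma mscale_nth: "mscale c a $ i $ j = c * a $ i $ j"
  by (simp add: mscale_def)

lemma mat_unit_nth: "mat_unit i j $ k $ l = (if k = i \<and> l = j then 1 else 0)"
  by (simp add: mat_unit_def)

lemma mat_1_nth: "mat 1 $ i $ j = (if i = j then 1 else 0)"
  by (simp add: mat_def)

lemma sum_UNIV_pair: "(\<Sum>p\<in>UNIV. f p) = (\<Sum>x\<in>UNIV. \<Sum>y\<in>UNIV. f (x, y))"
  by (simp add: sum.cartesian_product flip: UNIV_Times_UNIV)

lemma matrix_mult_add_left:
  fixes b c :: "complex^'n::finite^'m"
  shows "(b + c) ** a = b ** a + c ** a"
  by (simp add: matrix_matrix_mult_def vec_eq_iff sum.distrib distrib_right)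

lemma mscale_0 [simp]: "mscale 0 a = 0"
  by (simp add: mscale_def vec_eq_iff)

lemma matrix_mult_sum_left:
  fixes a :: "'i \<Rightarrow> complex^'n::finite^'m"
  shows "(\<Sum>s\<in>S. a s) ** b = (\<Sum>s\<in>S. a s ** b)"
  by (induction S rule: infinite_finite_induct) (auto simp: matrix_mult_add_left)

lemma matrix_mult_sum_right:
  fixes b :: "'i \<Rightarrow> complex^'n^'m::finite"
  shows "a ** (\<Sum>s\<in>S. b s) = (\<Sum>s\<in>S. a ** b s)"
  by (induction S rule: infinite_finite_induct) (auto simp: matrix_add_ldistrib)

lemma matrix_mult_mscale_right: "a ** mscale c b = mscale c (a ** b)"
  by (simp add: mscale_def matrix_matrix_mult_def vec_eq_iff sum_distrib_left mult_ac)

lemma matrix_mult_unit_nth: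
  "(a ** mat_unit k l) $ i $ j = (if j = l then a $ i $ k else 0)"
  by (auto simp: matrix_matrix_mult_def mat_unit_def if_distrib[where f = "\<lambda>z. _ * z"] cong: if_cong)

lemma matrix_expand_units:
  fixes a :: "complex^'n::finite^'m::finite"
  shows "a = (\<Sum>i\<in>UNIV. \<Sum>j\<in>UNIV. mscale (a $ i $ j) (mat_unit i j))"
proof -
  have "(\<Sum>i\<in>UNIV. \<Sum>j\<in>UNIV. a $ i $ j * (if k = i \<and> l = j then 1 else 0)) = a $ k $ l" for k l
  proof -
    have "(\<Sum>i\<in>UNIV. \<Sum>j\<in>UNIV. a $ i $ j * (if k = i \<and> l = j then 1 else 0))
        = (\<Sum>i\<in>UNIV. if k = i then (\<Sum>j\<in>UNIV. if l = j then a $ i $ j else 0) else 0)"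
      by (intro sum.cong refl) (auto simp: mult_delta_right)
    then show ?thesis by simp
  qed
  then show ?thesis by (simp add: vec_eq_iff mscale_def mat_unit_def)
qed

lemma trace_sum:
  fixes a :: "'i \<Rightarrow> complex^'n::finite^'n"
  shows "trace (\<Sum>s\<in>S. a s) = (\<Sum>s\<in>S. trace (a s))"
  unfolding trace_def sum_component by (rule sum.swap)

lemma hs_inner_self:
  fixes a :: "complex^'n::finite^'n"
  shows "hs_inner a a = of_real (\<Sum>i\<in>UNIV. \<Sum>k\<in>UNIV. (cmod (a $ k $ i))\<^sup>2)"
  by (simp add: hs_inner_def trace_def dagger_def matrix_matrix_mult_def mult.commute
      flip: complex_norm_square)

lemma hs_inner_self_eq_0:
  fixes a :: "complex^'n::finite^'n"
  shows "hs_inner a a = 0 \<longleftrightarrow> a = 0"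
proof -
  have "hs_inner a a = 0 \<longleftrightarrow> (\<forall>i k. a $ k $ i = 0)"
    unfolding hs_inner_self
    by (subst of_real_eq_0_iff) (simp add: sum_nonneg_eq_0_iff sum_nonneg)
  then show ?thesis by (auto simp: vec_eq_iff)
qed

section \<open>Quantum sets and adjoints\<close>

lemma qset_const [simp]: "qset (\<lambda>_. c) = UNIV"
  by (simp add: qset_def)

lemma mat_1_in_qset [simp]: "mat 1 \<in> qset \<beta>"
  by (auto simp: qset_def mat_def)

lemma dagger_in_qset: "a \<in> qset \<beta> \<Longrightarrow> dagger a \<in> qset \<beta>"
  by (auto simp: qset_def dagger_def)

lemma mult_in_qset: "a \<in> qset \<beta> \<Longrightarrow> b \<in> qset \<beta> \<Longrightarrow> a ** b \<in> qset \<beta>"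
  unfolding qset_def matrix_matrix_mult_def
  by (auto intro!: sum.neutral) (metis)

lemma mscale_in_qset: "a \<in> qset \<beta> \<Longrightarrow> mscale c a \<in> qset \<beta>"
  by (auto simp: qset_def mscale_def)

lemma sum_in_qset: "(\<And>s. s \<in> S \<Longrightarrow> f s \<in> qset \<beta>) \<Longrightarrow> (\<Sum>s\<in>S. f s) \<in> qset \<beta>"
  by (auto simp: qset_def intro!: sum.neutral)

lemma unit_in_qset: "\<beta> i = \<beta> j \<Longrightarrow> mat_unit i j \<in> qset \<beta>"
  by (auto simp: qset_def mat_unit_def)

abbreviation block_dim :: "('n \<Rightarrow> 'b) \<Rightarrow> 'n \<Rightarrow> complex" where
  "block_dim \<beta> j \<equiv> of_nat (card (\<beta> -` {\<beta> j}))"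

lemma block_dim_nonzero: "block_dim \<beta> (j :: 'n::finite) \<noteq> 0"
  by (auto simp: card_eq_0_iff)

lemma qinner_entries:
  fixes \<beta> :: "'n::finite \<Rightarrow> 'b"
  shows "qinner \<beta> a b = (\<Sum>j\<in>UNIV. \<Sum>i\<in>UNIV. block_dim \<beta> j * (cnj (a $ i $ j) * b $ i $ j))"
proof -
  have "qinner \<beta> a b =
      (\<Sum>c\<in>range \<beta>. \<Sum>j | j \<in> UNIV \<and> \<beta> j = c. block_dim \<beta> j * (dagger a ** b) $ j $ j)"
    unfolding qinner_def by (intro sum.cong refl) (auto simp: sum_distrib_left vimage_def)
  also have "\<dots> = (\<Sum>j\<in>UNIV. block_dim \<beta> j * (dagger a ** b) $ j $ j)"
    by (rule sum.group) auto
  finally show ?thesis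
    by (simp add: dagger_def matrix_matrix_mult_def sum_distrib_left)
qed

text \<open>Pairing with a matrix unit of the quantum set reads off one entry, scaled by the block size.\<close>

lemma qinner_nondegenerate:
  fixes \<beta> :: "'n::finite \<Rightarrow> 'b"
  assumes "a \<in> qset \<beta>" "b \<in> qset \<beta>" "\<And>x. x \<in> qset \<beta> \<Longrightarrow> qinner \<beta> x a = qinner \<beta> x b"
  shows "a = b"
proof -
  have *: "qinner \<beta> (mat_unit i j) c = block_dim \<beta> j * c $ i $ j" for i j c
  proof -
    have "qinner \<beta> (mat_unit i j) c
        = (\<Sum>l\<in>UNIV. if l = j then (\<Sum>k\<in>UNIV. if k = i then block_dim \<beta> l * c $ k $ l else 0) else 0)"
      unfolding qinner_entries by (intro sum.cong refl) (auto simp: mat_unit_nth if_distrib[where f = cnj] mult_delta_left mult_delta_right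
          cong: if_cong)
    then show ?thesis by simp
  qed
  have "a $ i $ j = b $ i $ j" for i j
  proof (cases "\<beta> i = \<beta> j")
    case True
    then show ?thesis
      using assms(3)[OF unit_in_qset[of \<beta> i j]] block_dim_nonzero[of \<beta> j] by (simp add: *)
  next
    case False
    then show ?thesis using assms(1,2) by (simp add: qset_def)
  qed
  then show ?thesis by (simp add: vec_eq_iff)
qed

lemma qadjoint_eqI:
  fixes \<beta> :: "'n::finite \<Rightarrow> 'b"
  assumes "a \<in> qset \<beta>" "\<And>x. x \<in> qset \<beta> \<Longrightarrow> qinner \<beta> x a = qinner \<gamma> (f x) b"
  shows "qadjoint \<beta> \<gamma> f b = a"
  unfolding qadjoint_def
  using assms by (intro the_equality) (auto intro!: qinner_nondegenerate)

lemma qadjoint_left_mult: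
  fixes \<beta> :: "'n::finite \<Rightarrow> 'b"
  assumes "p \<in> qset \<beta>" "a \<in> qset \<beta>" "\<And>x. x \<in> qset \<beta> \<Longrightarrow> f x = p ** x"
  shows "qadjoint \<beta> \<beta> f a = dagger p ** a"
  using assms
  by (intro qadjoint_eqI)
    (auto simp: qinner_def dagger_mult matrix_mul_assoc dagger_in_qset mult_in_qset)

section \<open>Tensor maps and the comultiplication\<close>

lemma qlinear_sum:
  assumes "qlinear \<beta> \<gamma> f" "\<And>s. s \<in> S \<Longrightarrow> a s \<in> qset \<beta>"
  shows "f (\<Sum>s\<in>S. a s) = (\<Sum>s\<in>S. f (a s))"
proof -
  have 0: "f 0 = 0"
  proof -
    have "f (mscale 0 (mat 1)) = mscale 0 (f (mat 1))"
      using assms(1) mat_1_in_qset unfolding qlinear_def by blast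
    then show ?thesis by simp
  qed
  show ?thesis
    using assms(2)
  proof (induction S rule: infinite_finite_induct)
    case (insert s S)
    then have "f (a s + sum a S) = f (a s) + f (sum a S)"
      using assms(1) sum_in_qset[of S a \<beta>] unfolding qlinear_def by blast
    then show ?case using insert by simp
  qed (auto simp: 0)
qed

text \<open>
  A map on a quantum set may take meaningless values on matrix units across two blocks; those
  enter with the coefficient zero.
\<close>

lemma qlinear_expand_units:
  fixes \<beta> :: "'n::finite \<Rightarrow> 'b"
  assumes "qlinear \<beta> \<gamma> f" "a \<in> qset \<beta>"
  shows "f a = (\<Sum>i\<in>UNIV. \<Sum>j\<in>UNIV. mscale (a $ i $ j) (f (mat_unit i j)))"
proof -
  have in_q: "mscale (a $ i $ j) (mat_unit i j) \<in> qset \<beta>" for i j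
    using assms(2) by (auto simp: qset_def mscale_def mat_unit_def)
  have scale: "f (mscale (a $ i $ j) (mat_unit i j)) = mscale (a $ i $ j) (f (mat_unit i j))" for i j
  proof (cases "\<beta> i = \<beta> j")
    case True
    then show ?thesis using assms(1) unit_in_qset[of \<beta> i j] by (simp add: qlinear_def)
  next
    case False
    then have "a $ i $ j = 0" using assms(2) by (simp add: qset_def)
    then show ?thesis using qlinear_sum[OF assms(1), of "{}"] by simp
  qed
  have "f a = f (\<Sum>i\<in>UNIV. \<Sum>j\<in>UNIV. mscale (a $ i $ j) (mat_unit i j))"
    by (subst matrix_expand_units[of a]) simp
  also have "\<dots> = (\<Sum>i\<in>UNIV. \<Sum>j\<in>UNIV. f (mscale (a $ i $ j) (mat_unit i j)))"
    by (simp add: qlinear_sum[OF assms(1)] in_q sum_in_qset)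
  finally show ?thesis by (simp add: scale)
qed

lemma tensor_map_nth:
  "tensor_map f g T $ (i, a) $ (k, b) =
     (\<Sum>p1\<in>UNIV. \<Sum>p2\<in>UNIV. \<Sum>q1\<in>UNIV. \<Sum>q2\<in>UNIV.
        T $ (p1, p2) $ (q1, q2) * (f (mat_unit p1 q1) $ i $ k * g (mat_unit p2 q2) $ a $ b))"
  by (simp add: tensor_map_def tensor_def mscale_def sum_UNIV_pair)

lemma tensor_map_tensor:
  fixes \<beta> :: "'n::finite \<Rightarrow> 'b" and \<beta>' :: "'m::finite \<Rightarrow> 'c"
    and f :: "complex^'n^'n \<Rightarrow> complex^'k::finite^'k" and g :: "complex^'m^'m \<Rightarrow> complex^'l::finite^'l"
  assumes f: "qlinear \<beta> \<gamma> f" "a \<in> qset \<beta>" and g: "qlinear \<beta>' \<gamma>' g" "b \<in> qset \<beta>'"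
  shows "tensor_map f g (tensor a b) = tensor (f a) (g b)"
proof -
  have "tensor_map f g (tensor a b) $ (i, c) $ (k, d) = f a $ i $ k * g b $ c $ d" for i c k d
  proof -
    have "f a $ i $ k * g b $ c $ d =
      (\<Sum>p1\<in>UNIV. \<Sum>q1\<in>UNIV. a $ p1 $ q1 * f (mat_unit p1 q1) $ i $ k) *
      (\<Sum>p2\<in>UNIV. \<Sum>q2\<in>UNIV. b $ p2 $ q2 * g (mat_unit p2 q2) $ c $ d)"
      by (simp add: qlinear_expand_units[OF f] qlinear_expand_units[OF g] mscale_def)
    also have "\<dots> = (\<Sum>p1\<in>UNIV. \<Sum>p2\<in>UNIV.
      (\<Sum>q1\<in>UNIV. a $ p1 $ q1 * f (mat_unit p1 q1) $ i $ k) *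
      (\<Sum>q2\<in>UNIV. b $ p2 $ q2 * g (mat_unit p2 q2) $ c $ d))"
      by (rule sum_product)
    also have "\<dots> = tensor_map f g (tensor a b) $ (i, c) $ (k, d)"
      unfolding tensor_map_nth sum_product by (simp add: tensor_def mult_ac)
    finally show ?thesis by simp
  qed
  then show ?thesis by (simp add: vec_eq_iff tensor_def)
qed

text \<open>
  Applying a map to the second tensor factor acts separately on each slice with fixed row and
  column in the first factor.
\<close>

lemma tensor_map_id_nth:
  fixes g :: "complex^'m::finite^'m \<Rightarrow> complex^'l::finite^'l"
    and T :: "complex^('n::finite \<times> 'm)^('n \<times> 'm)"
  assumes "qlinear \<beta> \<gamma> g" "(\<chi> p q. T $ (i, p) $ (k, q)) \<in> qset \<beta>"
  shows "tensor_map id g T $ (i, a) $ (k, b) = g (\<chi> p q. T $ (i, p) $ (k, q)) $ a $ b"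
proof -
  have "tensor_map id g T $ (i, a) $ (k, b) =
     (\<Sum>p1\<in>UNIV. if p1 = i then \<Sum>p2\<in>UNIV. \<Sum>q1\<in>UNIV. if q1 = k then \<Sum>q2\<in>UNIV.
        T $ (p1, p2) $ (q1, q2) * g (mat_unit p2 q2) $ a $ b else 0 else 0)"
    unfolding tensor_map_nth
  proof (rule sum.cong[OF refl])
    fix p1
    show "(\<Sum>p2\<in>UNIV. \<Sum>q1\<in>UNIV. \<Sum>q2\<in>UNIV.
        T $ (p1, p2) $ (q1, q2) * (id (mat_unit p1 q1) $ i $ k * g (mat_unit p2 q2) $ a $ b)) =
      (if p1 = i then \<Sum>p2\<in>UNIV. \<Sum>q1\<in>UNIV. if q1 = k then \<Sum>q2\<in>UNIV.
        T $ (p1, p2) $ (q1, q2) * g (mat_unit p2 q2) $ a $ b else 0 else 0)"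
    proof (cases "p1 = i")
      case True
      show ?thesis
        unfolding True if_P[OF refl] by (intro sum.cong refl) (auto simp: mat_unit_nth)
    qed (simp add: mat_unit_nth)
  qed
  also have "\<dots> = g (\<chi> p q. T $ (i, p) $ (k, q)) $ a $ b"
    by (simp add: qlinear_expand_units[OF assms] mscale_def)
  finally show ?thesis .
qed

lemma qlinear_id: "qlinear \<beta> \<beta> id"
  by (simp add: qlinear_def)

lemma qlinear_mult: "qlinear (\<lambda>_. ()) (\<lambda>_. ()) mult"
  by (simp add: qlinear_def mult_def mscale_def vec_eq_iff sum.distrib sum_distrib_left)

lemma qlinear_tensor_map: "qlinear (\<lambda>_. ()) (\<lambda>_. ()) (tensor_map f g)"
  by (simp add: qlinear_def vec_eq_iff split_paired_all mscale_def tensor_map_nth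
      sum.distrib sum_distrib_left distrib_right mult.assoc)

text \<open>
  In the weighted inner products, an entry of \<open>T\<close> at column \<open>(k, j)\<close> counts with the product of the two
  block sizes, an entry of \<open>mult T\<close> at column \<open>j\<close> only with the block size of \<open>j\<close>. The block size of
  \<open>k\<close> is therefore divided out in the adjoint of \<open>mult\<close>.
\<close>

lemma comult_eq:
  fixes \<beta> :: "'n::finite \<Rightarrow> 'b"
  assumes "x \<in> qset \<beta>"
  shows "comult \<beta> x =
    (\<chi> p q. if snd p = fst q \<and> \<beta> (fst p) = \<beta> (snd p)
      then x $ fst p $ snd q / block_dim \<beta> (fst p) else 0)" (is "_ = ?S")
  unfolding comult_def
proof (rule qadjoint_eqI)
  show "?S \<in> qset (map_prod \<beta> \<beta>)"
    using assms by (auto simp: qset_def)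
next
  fix T :: "complex^('n\<times>'n)^('n\<times>'n)"
  assume T: "T \<in> qset (map_prod \<beta> \<beta>)"
  have bd: "block_dim (map_prod \<beta> \<beta>) (k, j) = block_dim \<beta> k * block_dim \<beta> j" for k j
  proof -
    have "map_prod \<beta> \<beta> -` {map_prod \<beta> \<beta> (k, j)} = (\<beta> -` {\<beta> k}) \<times> (\<beta> -` {\<beta> j})" by auto
    then show ?thesis by (simp add: card_cartesian_product)
  qed
  have entry: "block_dim \<beta> k * block_dim \<beta> j * (cnj (T $ (i, l) $ (k, j)) * ?S $ (i, l) $ (k, j))
      = (if l = k then block_dim \<beta> j * (cnj (T $ (i, l) $ (k, j)) * x $ i $ j) else 0)" for i j k l
  proof (cases "l = k \<and> \<beta> i = \<beta> k")
    case True
    then show ?thesis using block_dim_nonzero[of \<beta> k] by simp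
  next
    case False
    moreover have "\<beta> i \<noteq> \<beta> k \<Longrightarrow> T $ (i, l) $ (k, j) = 0"
      using T by (simp add: qset_def)
    ultimately show ?thesis by auto
  qed
  have "qinner (map_prod \<beta> \<beta>) T ?S = (\<Sum>k\<in>UNIV. \<Sum>j\<in>UNIV. \<Sum>i\<in>UNIV. \<Sum>l\<in>UNIV.
      block_dim \<beta> k * block_dim \<beta> j * (cnj (T $ (i, l) $ (k, j)) * ?S $ (i, l) $ (k, j)))"
    by (simp only: qinner_entries sum_UNIV_pair bd)
  also have "\<dots> = (\<Sum>k\<in>UNIV. \<Sum>j\<in>UNIV. \<Sum>i\<in>UNIV. block_dim \<beta> j * (cnj (T $ (i, k) $ (k, j)) * x $ i $ j))"
    unfolding entry by simp
  also have "\<dots> = (\<Sum>j\<in>UNIV. \<Sum>k\<in>UNIV. \<Sum>i\<in>UNIV. block_dim \<beta> j * (cnj (T $ (i, k) $ (k, j)) * x $ i $ j))"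
    by (rule sum.swap)
  also have "\<dots> = (\<Sum>j\<in>UNIV. \<Sum>i\<in>UNIV. \<Sum>k\<in>UNIV. block_dim \<beta> j * (cnj (T $ (i, k) $ (k, j)) * x $ i $ j))"
    by (rule sum.cong[OF refl], rule sum.swap)
  also have "\<dots> = qinner \<beta> (mult T) x"
    unfolding qinner_entries by (simp add: mult_def sum_distrib_left sum_distrib_right)
  finally show "qinner (map_prod \<beta> \<beta>) T ?S = qinner \<beta> (mult T) x" .
qed

lemma qlinear_comult:
  fixes \<beta> :: "'n::finite \<Rightarrow> 'b"
  shows "qlinear \<beta> (\<lambda>_. ()) (comult \<beta>)"
proof -
  have "a + b \<in> qset \<beta>" if "a \<in> qset \<beta>" "b \<in> qset \<beta>" for a b
    using that by (auto simp: qset_def)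
  then show ?thesis
    by (auto simp: qlinear_def comult_eq mscale_in_qset mscale_nth vec_eq_iff add_divide_distrib)
qed

section \<open>The edge relation\<close>

lemma mat_1_tensor: "mat 1 = tensor (mat 1) (mat 1)"
  by (auto simp: tensor_def mat_def vec_eq_iff)

text \<open>
  Evaluated at \<open>1 \<otimes> 1\<close>, the defining composite of \<open>edge_rel\<close> first forms \<open>m\<^sup>\<dagger>(1) \<otimes> 1\<close> and finally
  multiplies the second factor by this trailing \<open>1\<close>.
\<close>

lemma pset_proj_edge_rel:
  fixes \<beta> :: "'n::finite \<Rightarrow> 'b"
  shows "pset_proj (edge_rel \<beta> A) = tensor_map id A (comult \<beta> (mat 1))" (is "_ = ?S")
proof -
  have "tensor_map id mult (assoc (tensor ?S (mat 1))) $ (i, a) $ (k, b) = ?S $ (i, a) $ (k, b)"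
    for i a k b
    by (subst tensor_map_id_nth[OF qlinear_mult])
      (simp_all add: mult_def assoc_def tensor_def mat_def if_distrib[where f = "\<lambda>z. _ * z"]
        cong: if_cong)
  then have "tensor_map id mult (assoc (tensor ?S (mat 1))) = ?S"
    by (simp add: vec_eq_iff)
  then show ?thesis
    unfolding pset_proj_def edge_rel_def mat_1_tensor
    by (simp add: tensor_map_tensor[OF qlinear_comult _ qlinear_id[of "\<lambda>_. ()"]]
        tensor_map_tensor[OF qlinear_tensor_map _ qlinear_id[of "\<lambda>_. ()"]])
qed

lemma pset_proj_edge_rel_nth:
  fixes \<beta> :: "'n::finite \<Rightarrow> 'b"
  assumes "qlinear \<beta> \<beta> A"
  shows "pset_proj (edge_rel \<beta> A) $ (i, a) $ (k, b) =
    (if \<beta> i = \<beta> k then A (mat_unit k i) $ a $ b / block_dim \<beta> i else 0)"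
proof -
  define c where "c = (if \<beta> i = \<beta> k then 1 / block_dim \<beta> i else 0)"
  have slice: "(\<chi> p q. comult \<beta> (mat 1) $ (i, p) $ (k, q)) = mscale c (mat_unit k i)"
  proof -
    have "comult \<beta> (mat 1) $ (i, p) $ (k, q) = c * mat_unit k i $ p $ q" for p q
      unfolding comult_eq[OF mat_1_in_qset] c_def by (simp add: mat_unit_nth mat_1_nth)
    then show ?thesis by (simp add: vec_eq_iff mscale_nth)
  qed
  have in_q: "mscale c (mat_unit k i) \<in> qset \<beta>"
    by (auto simp: c_def qset_def mscale_def mat_unit_def)
  have "A (mscale c (mat_unit k i)) = mscale c (A (mat_unit k i))"
  proof (cases "\<beta> i = \<beta> k")
    case True
    then show ?thesis using assms unit_in_qset[of \<beta> k i] by (simp add: qlinear_def)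
  next
    case False
    then show ?thesis using qlinear_sum[OF assms, of "{}"] by (simp add: c_def)
  qed
  then show ?thesis
    unfolding pset_proj_edge_rel
    by (subst tensor_map_id_nth[OF assms]) (simp_all add: slice in_q, simp add: c_def mscale_nth)
qed

text \<open>
  In \<open>q E(x) r\<close>, entry \<open>(a, b)\<close>, the coefficient of \<open>x $ k $ l\<close> involves \<open>A\<close> applied to the units
  \<open>mat_unit j l\<close>, with weights \<open>r $ j $ b\<close>. By linearity these combine to \<open>A\<close> at
  \<open>(\<Sum>j. r $ j $ b \<cdot> mat_unit j l) = r ** mat_unit b l\<close>: the factor \<open>r\<close> has moved from the right of the
  action into the argument of \<open>A\<close>. The assumption that \<open>r\<close> is block-diagonal keeps all these units
  inside the quantum set.
\<close>

lemma compressed_edge_action_nth: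
  fixes \<beta> :: "'n::finite \<Rightarrow> 'b" and q r x :: "complex^'n^'n"
  assumes A: "qlinear \<beta> \<beta> A" and r: "r \<in> qset \<beta>"
  shows "(q ** op_action (pset_proj (edge_rel \<beta> A)) x ** r) $ a $ b =
    (\<Sum>k\<in>UNIV. \<Sum>l\<in>UNIV. x $ k $ l *
      (if \<beta> b = \<beta> l then (q ** A (r ** mat_unit b l)) $ a $ k / block_dim \<beta> l else 0))"
proof -
  let ?E = "pset_proj (edge_rel \<beta> A)"
  have inner: "(\<Sum>i\<in>UNIV. \<Sum>j\<in>UNIV. q $ a $ i * ?E $ (l, i) $ (j, k) * r $ j $ b) =
      (if \<beta> b = \<beta> l then (q ** A (r ** mat_unit b l)) $ a $ k / block_dim \<beta> l else 0)" for k l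
  proof (cases "\<beta> b = \<beta> l")
    case False
    have "q $ a $ i * ?E $ (l, i) $ (j, k) * r $ j $ b = 0" for i j
      using False r by (auto simp: pset_proj_edge_rel_nth[OF A] qset_def)
    then show ?thesis by (simp only: False sum.neutral_const if_False)
  next
    case True
    have in_q: "mscale (r $ j $ b) (mat_unit j l) \<in> qset \<beta>" for j
      using True r by (auto simp: qset_def mscale_def mat_unit_def)
    have "r ** mat_unit b l = (\<Sum>j\<in>UNIV. mscale (r $ j $ b) (mat_unit j l))"
    proof -
      have "(r ** mat_unit b l) $ i $ c = (\<Sum>j\<in>UNIV. r $ j $ b * mat_unit j l $ i $ c)" for i c
        by (cases "c = l") (simp_all add: matrix_mult_unit_nth mat_unit_nth mult_delta_right)
      then show ?thesis by (simp add: vec_eq_iff mscale_nth)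
    qed
    then have "A (r ** mat_unit b l) = (\<Sum>j\<in>UNIV. A (mscale (r $ j $ b) (mat_unit j l)))"
      by (simp add: qlinear_sum[OF A] in_q)
    also have "\<dots> = (\<Sum>j\<in>UNIV. mscale (block_dim \<beta> l * r $ j $ b) (\<chi> i k. ?E $ (l, i) $ (j, k)))"
    proof (intro sum.cong refl)
      fix j
      show "A (mscale (r $ j $ b) (mat_unit j l)) =
          mscale (block_dim \<beta> l * r $ j $ b) (\<chi> i k. ?E $ (l, i) $ (j, k))"
      proof (cases "\<beta> j = \<beta> l")
        case jl: True
        then have "A (mscale (r $ j $ b) (mat_unit j l)) = mscale (r $ j $ b) (A (mat_unit j l))"
          using A unit_in_qset[of \<beta> j l] by (simp add: qlinear_def)
        then show ?thesis
          using jl block_dim_nonzero[of \<beta> l]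
          by (simp add: pset_proj_edge_rel_nth[OF A] mscale_def vec_eq_iff)
      next
        case False
        then have "r $ j $ b = 0" using True r by (simp add: qset_def)
        then show ?thesis using qlinear_sum[OF A, of "{}"] by simp
      qed
    qed
    finally have *: "A (r ** mat_unit b l) $ i $ k =
        block_dim \<beta> l * (\<Sum>j\<in>UNIV. ?E $ (l, i) $ (j, k) * r $ j $ b)" for i k
      by (simp add: mscale_def sum_distrib_left mult_ac)
    have "(q ** A (r ** mat_unit b l)) $ a $ k =
        block_dim \<beta> l * (\<Sum>i\<in>UNIV. \<Sum>j\<in>UNIV. q $ a $ i * ?E $ (l, i) $ (j, k) * r $ j $ b)"
      by (simp add: matrix_matrix_mult_def[of q] * sum_distrib_left mult_ac)
    then show ?thesis using True block_dim_nonzero[of \<beta> l] by simp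
  qed
  have "(q ** op_action ?E x ** r) $ a $ b =
      (\<Sum>j\<in>UNIV. \<Sum>i\<in>UNIV. \<Sum>k\<in>UNIV. \<Sum>l\<in>UNIV.
         x $ k $ l * (q $ a $ i * ?E $ (l, i) $ (j, k) * r $ j $ b))"
    by (simp add: op_action_def matrix_matrix_mult_def sum_distrib_left sum_distrib_right mult_ac)
  also have "\<dots> = (\<Sum>(j,i)\<in>UNIV. \<Sum>(k,l)\<in>UNIV.
         x $ k $ l * (q $ a $ i * ?E $ (l, i) $ (j, k) * r $ j $ b))"
    by (simp only: sum_UNIV_pair split)
  also have "\<dots> = (\<Sum>(k,l)\<in>UNIV. \<Sum>(j,i)\<in>UNIV.
         x $ k $ l * (q $ a $ i * ?E $ (l, i) $ (j, k) * r $ j $ b))"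
    unfolding split_def by (rule sum.swap)
  also have "\<dots> = (\<Sum>k\<in>UNIV. \<Sum>l\<in>UNIV. \<Sum>j\<in>UNIV. \<Sum>i\<in>UNIV.
         x $ k $ l * (q $ a $ i * ?E $ (l, i) $ (j, k) * r $ j $ b))"
    by (simp only: sum_UNIV_pair split)
  also have "\<dots> = (\<Sum>k\<in>UNIV. \<Sum>l\<in>UNIV. \<Sum>i\<in>UNIV. \<Sum>j\<in>UNIV.
         x $ k $ l * (q $ a $ i * ?E $ (l, i) $ (j, k) * r $ j $ b))"
    by (rule sum.cong[OF refl], rule sum.cong[OF refl], rule sum.swap)
  finally show ?thesis
    by (simp add: inner flip: sum_distrib_left)
qed

text \<open>
  Choosing \<open>x\<close> as a matrix unit isolates a single coefficient in \<open>compressed_edge_action_nth\<close>.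
\<close>

lemma compressed_edge_action_eq_0_iff:
  fixes \<beta> :: "'n::finite \<Rightarrow> 'b" and q r :: "complex^'n^'n"
  assumes A: "qlinear \<beta> \<beta> A" and r: "r \<in> qset \<beta>"
  shows "(\<forall>x. q ** op_action (pset_proj (edge_rel \<beta> A)) x ** r = 0) \<longleftrightarrow>
    (\<forall>x\<in>qset \<beta>. q ** A (r ** x) = 0)"
proof (intro iffI allI ballI)
  fix x :: "complex^'n^'n"
  assume "\<forall>x\<in>qset \<beta>. q ** A (r ** x) = 0"
  then have "q ** A (r ** mat_unit b l) = 0" if "\<beta> b = \<beta> l" for b l
    using that unit_in_qset[of \<beta> b l] by blast
  then show "q ** op_action (pset_proj (edge_rel \<beta> A)) x ** r = 0"
    by (auto simp: vec_eq_iff compressed_edge_action_nth[OF A r] intro!: sum.neutral)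
next
  fix x assume x: "x \<in> qset \<beta>"
  assume L: "\<forall>x. q ** op_action (pset_proj (edge_rel \<beta> A)) x ** r = 0"
  have units: "q ** A (r ** mat_unit b l) = 0" if "\<beta> b = \<beta> l" for b l
  proof -
    have "(q ** A (r ** mat_unit b l)) $ a $ k = 0" for a k
    proof -
      have "0 = (q ** op_action (pset_proj (edge_rel \<beta> A)) (mat_unit k l) ** r) $ a $ b"
        using L by simp
      also have "\<dots> = (\<Sum>k'\<in>UNIV. if k' = k then \<Sum>l'\<in>UNIV. if l' = l then
          (if \<beta> b = \<beta> l' then (q ** A (r ** mat_unit b l')) $ a $ k' / block_dim \<beta> l' else 0)
          else 0 else 0)"
        unfolding compressed_edge_action_nth[OF A r]
      proof (rule sum.cong[OF refl])
        fix k' :: 'n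
        let ?X = "\<lambda>l'. if \<beta> b = \<beta> l' then (q ** A (r ** mat_unit b l')) $ a $ k' / block_dim \<beta> l' else 0"
        show "(\<Sum>l'\<in>UNIV. mat_unit k l $ k' $ l' * ?X l') =
            (if k' = k then \<Sum>l'\<in>UNIV. if l' = l then ?X l' else 0 else 0)"
          by (cases "k' = k") (simp_all add: mat_unit_nth mult_delta_left)
      qed
      also have "\<dots> = (q ** A (r ** mat_unit b l)) $ a $ k / block_dim \<beta> l"
        using that by simp
      finally show ?thesis using block_dim_nonzero[of \<beta> l] by simp
    qed
    then show ?thesis by (simp add: vec_eq_iff)
  qed
  have rx: "qlinear \<beta> \<beta> (\<lambda>x. A (r ** x))"
    using A r
    by (auto simp: qlinear_def mult_in_qset matrix_add_ldistrib matrix_mult_mscale_right)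
  have "mscale (x $ i $ j) (q ** A (r ** mat_unit i j)) = 0" for i j
    using units[of i j] x by (cases "\<beta> i = \<beta> j") (auto simp: qset_def mscale_def vec_eq_iff)
  then show "q ** A (r ** x) = 0"
    by (subst qlinear_expand_units[OF rx x])
      (simp add: matrix_mult_sum_right matrix_mult_mscale_right)
qed

lemma pset_proj_times: "pset_proj (pset_times Y Z) = tensor (pset_proj Y) (pset_proj Z)"
proof -
  have "qlinear (\<lambda>_. ()) (\<lambda>_. ()) (\<lambda>x. x ** pset_proj Y)"
    by (simp add: qlinear_def matrix_mult_add_left mscale_def matrix_matrix_mult_def vec_eq_iff
        sum_distrib_left mult_ac distrib_right distrib_left sum.distrib)
  moreover have "qlinear (\<lambda>_. ()) (\<lambda>_. ()) (\<lambda>x. pset_proj Z ** x)"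
    by (simp add: qlinear_def matrix_add_ldistrib matrix_mult_mscale_right)
  ultimately show ?thesis
    unfolding pset_times_def
    by (subst pset_proj_def, subst mat_1_tensor, subst tensor_map_tensor) auto
qed

text \<open>
  Projections can be moved across the Hilbert-Schmidt inner product, by cyclicity of the trace, so
  orthogonality to all \<open>Z v Y\<close> is orthogonality of the compression to all matrices \<open>v\<close>.
\<close>

lemma op_disjoint_times_iff:
  fixes Y Z :: "complex^'n::finite^'n \<Rightarrow> complex^'n^'n"
  assumes Y: "is_projection (pset_proj Y)" and Z: "is_projection (pset_proj Z)"
  shows "op_disjoint E (pset_times Y Z) \<longleftrightarrow>
    (\<forall>x. pset_proj Z ** op_action (pset_proj E) x ** pset_proj Y = 0)"
proof -
  let ?y = "pset_proj Y" and ?z = "pset_proj Z"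
  have move: "hs_inner w (?z ** v ** ?y) = hs_inner (?z ** w ** ?y) v" for w v
  proof -
    have "hs_inner w (?z ** v ** ?y) = trace ((dagger w ** ?z ** v) ** ?y)"
      by (simp add: hs_inner_def matrix_mul_assoc)
    also have "\<dots> = trace (?y ** (dagger w ** ?z ** v))"
      by (rule trace_mul_sym)
    also have "\<dots> = hs_inner (?z ** w ** ?y) v"
      using Y Z by (simp add: is_projection_def hs_inner_def dagger_mult matrix_mul_assoc)
    finally show ?thesis .
  qed
  have zero: "(\<forall>v. hs_inner w v = 0) \<longleftrightarrow> w = 0" for w :: "complex^'n^'n"
    using hs_inner_self_eq_0[of w] by (auto simp: hs_inner_def trace_def)
  show ?thesis
    by (simp add: op_disjoint_def op_img_def pset_proj_times op_action_tensor move zero)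
qed

section \<open>Projections and partitions\<close>

lemma img_orthogonal_iff:
  fixes p q :: "complex^'n::finite^'n"
  shows "(\<forall>u\<in>img p. \<forall>v\<in>img q. cdot u v = 0) \<longleftrightarrow> dagger p ** q = 0"
proof -
  have adj: "cdot (p *v u) w = cdot u (dagger p *v w)" for u w
    by (simp add: cdot_def matrix_vector_mult_def dagger_def sum_distrib_left sum_distrib_right mult_ac)
      (rule sum.swap)
  have nd: "(\<forall>u. cdot u w = 0) \<longleftrightarrow> w = 0" for w :: "complex^'n"
  proof
    assume *: "\<forall>u. cdot u w = 0"
    have "w $ i = 0" for i
      using *[rule_format, of "axis i 1"]
      by (simp add: cdot_def axis_def if_distrib[where f = cnj] if_distrib[where f = "\<lambda>z. z * _"]
          cong: if_cong)
    then show "w = 0" by (simp add: vec_eq_iff)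
  qed (simp add: cdot_def)
  have "(\<forall>u\<in>img p. \<forall>v\<in>img q. cdot u v = 0) \<longleftrightarrow> (\<forall>v. (dagger p ** q) *v v = 0)"
    by (auto simp: img_def adj nd matrix_vector_mul_assoc simp flip: nd)
  also have "\<dots> \<longleftrightarrow> dagger p ** q = 0"
    by (simp add: matrix_eq)
  finally show ?thesis .
qed

text \<open>
  A projection fixes its range pointwise, so projections with the same range satisfy \<open>q ** p = p\<close> and
  \<open>p ** q = q\<close>; the involution turns the first equation into \<open>p ** q = p\<close>.
\<close>

lemma projection_img_inject:
  fixes p q :: "complex^'n::finite^'n"
  assumes p: "is_projection p" and q: "is_projection q" and "img p = img q"
  shows "p = q"
proof -
  have fixes_img: "b ** a = a" if b: "is_projection b" and sub: "img a \<subseteq> img b" for a b :: "complex^'n^'n"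
  proof -
    have "b *v (a *v u) = a *v u" for u
    proof -
      obtain w where "a *v u = b *v w" using sub by (auto simp: img_def)
      then show ?thesis using b by (simp add: is_projection_def matrix_vector_mul_assoc)
    qed
    then show ?thesis by (simp add: matrix_eq matrix_vector_mul_assoc)
  qed
  have "p = q ** p" using fixes_img[of q p] assms by simp
  then have "dagger p = dagger p ** dagger q" by (metis dagger_mult)
  also have "\<dots> = q" using p q fixes_img[of p q] assms by (simp add: is_projection_def)
  finally show ?thesis using p by (simp add: is_projection_def)
qed

text \<open>
  By orthogonality the sum of the \<open>p s\<close> absorbs every \<open>p t\<close>. This makes it idempotent and puts the
  range of \<open>p t\<close> inside its range.
\<close>

lemma projector_onto_span_orthogonal:
  fixes p :: "'i \<Rightarrow> complex^'n::finite^'n"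
  assumes fin: "finite S" and proj: "\<And>s. s \<in> S \<Longrightarrow> is_projection (p s)"
    and orth: "\<And>s t. s \<in> S \<Longrightarrow> t \<in> S \<Longrightarrow> s \<noteq> t \<Longrightarrow> p s ** p t = 0"
  shows "projector_onto (vec.span (\<Union>s\<in>S. img (p s))) = (\<Sum>s\<in>S. p s)"
proof -
  let ?q = "\<Sum>s\<in>S. p s"
  have absorb: "?q ** p t = p t" if "t \<in> S" for t
  proof -
    have "?q ** p t = (\<Sum>s\<in>S. if s = t then p t else 0)"
      unfolding matrix_mult_sum_left
      using that proj orth by (intro sum.cong) (auto simp: is_projection_def)
    then show ?thesis using that fin by simp
  qed
  have proj_q: "is_projection ?q"
    unfolding is_projection_def
    using absorb proj by (auto simp: matrix_mult_sum_right dagger_sum is_projection_def)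
  have sub: "vec.subspace (img ?q)"
    unfolding vec.subspace_def img_def
    by (auto simp: image_iff)
      (metis matrix_vector_mult_0_right, metis matrix_vector_right_distrib, metis vector_scalar_commute)
  have img_q: "img ?q = vec.span (\<Union>s\<in>S. img (p s))"
  proof
    have "?q *v u \<in> vec.span (\<Union>s\<in>S. img (p s))" for u
    proof -
      have "?q *v u = (\<Sum>s\<in>S. p s *v u)"
        using fin by (induction S) (auto simp: matrix_vector_mult_add_rdistrib)
      also have "\<dots> \<in> vec.span (\<Union>s\<in>S. img (p s))"
        by (intro vec.span_sum vec.span_base) (auto simp: img_def)
      finally show ?thesis .
    qed
    then show "img ?q \<subseteq> vec.span (\<Union>s\<in>S. img (p s))" by (auto simp: img_def)
    have "p s *v u \<in> img ?q" if "s \<in> S" for s u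
      using absorb[OF that] unfolding img_def by (metis matrix_vector_mul_assoc rangeI)
    then show "vec.span (\<Union>s\<in>S. img (p s)) \<subseteq> img ?q"
      by (intro vec.span_minimal sub) (auto simp: img_def)
  qed
  show ?thesis
    unfolding projector_onto_def
    using proj_q img_q by (intro the_equality) (auto intro: projection_img_inject)
qed

text \<open>
  Compressing the sum by \<open>p t\<close> gives \<open>p t = (\<Sum>r. p t ** p r ** p t)\<close>. The summand for \<open>r = t\<close> is
  already \<open>p t\<close>, so the others sum to \<open>0\<close>; their traces are the squared Hilbert-Schmidt norms of
  \<open>p r ** p t\<close>.
\<close>

lemma projections_sum_1_orthogonal:
  fixes p :: "'i \<Rightarrow> complex^'n::finite^'n"
  assumes fin: "finite S" and proj: "\<And>s. s \<in> S \<Longrightarrow> is_projection (p s)"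
    and one: "(\<Sum>s\<in>S. p s) = mat 1" and st: "s \<in> S" "t \<in> S" "s \<noteq> t"
  shows "p s ** p t = 0"
proof -
  define f where "f r = (\<Sum>i\<in>UNIV. \<Sum>k\<in>UNIV. (cmod ((p r ** p t) $ k $ i))\<^sup>2)" for r
  have hs: "hs_inner (p r ** p t) (p r ** p t) = of_real (f r)" for r
    unfolding f_def by (rule hs_inner_self)
  have sq: "dagger (p r ** p t) ** (p r ** p t) = p t ** p r ** p t" if "r \<in> S" for r
    using proj[OF that] proj[OF st(2)]
    by (simp add: dagger_mult is_projection_def) (metis matrix_mul_assoc)
  have "(\<Sum>r\<in>S. p t ** p r ** p t) = p t ** (\<Sum>r\<in>S. p r) ** p t"
    by (simp add: matrix_mult_sum_left matrix_mult_sum_right)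
  also have "\<dots> = p t ** p t ** p t" using one proj[OF st(2)] by (simp add: is_projection_def)
  finally have "(\<Sum>r\<in>S - {t}. p t ** p r ** p t) = 0"
    using fin st(2) by (simp add: sum.remove)
  then have "(\<Sum>r\<in>S - {t}. trace (p t ** p r ** p t)) = 0"
    by (simp only: flip: trace_sum) (simp add: trace_def)
  also have "(\<Sum>r\<in>S - {t}. trace (p t ** p r ** p t)) = (\<Sum>r\<in>S - {t}. of_real (f r))"
  proof (rule sum.cong[OF refl])
    fix r assume "r \<in> S - {t}"
    then have "trace (p t ** p r ** p t) = hs_inner (p r ** p t) (p r ** p t)"
      by (simp add: hs_inner_def sq)
    then show "trace (p t ** p r ** p t) = of_real (f r)"
      by (simp only: hs)
  qed
  finally have "complex_of_real (\<Sum>r\<in>S - {t}. f r) = 0" by simp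
  then have "(\<Sum>r\<in>S - {t}. f r) = 0" by (subst (asm) of_real_eq_0_iff)
  then have "f s = 0"
    using fin st by (subst (asm) sum_nonneg_eq_0_iff) (auto simp: f_def sum_nonneg)
  then have "hs_inner (p s ** p t) (p s ** p t) = 0" by (simp add: hs)
  then show ?thesis by (simp only: hs_inner_self_eq_0)
qed

text \<open>
  Since \<open>Y\<close> is left multiplication by \<open>Y 1\<close>, its adjoint is left multiplication by \<open>dagger (Y 1)\<close>;
  idempotence and self-adjointness pass from the map to the matrix by evaluating at \<open>1\<close>.
\<close>

lemma proj_subset_proj:
  fixes \<beta> :: "'n::finite \<Rightarrow> 'b"
  assumes Y: "proj_subset \<beta> Y"
  shows "pset_proj Y \<in> qset \<beta>" "is_projection (pset_proj Y)"
proof -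
  let ?p = "pset_proj Y"
  show p: "?p \<in> qset \<beta>"
    using Y by (simp add: proj_subset_def qlinear_def pset_proj_def)
  have left: "Y a = ?p ** a" if "a \<in> qset \<beta>" for a
  proof -
    have "Y (mat 1 ** a) = Y (mat 1) ** a"
      using Y that mat_1_in_qset unfolding proj_subset_def by blast
    then show ?thesis by (simp add: pset_proj_def)
  qed
  have "Y (Y (mat 1)) = Y (mat 1)"
    using Y mat_1_in_qset unfolding proj_subset_def by blast
  then have "?p ** ?p = ?p" using left[OF p] by (simp add: pset_proj_def)
  moreover have "dagger ?p = ?p"
  proof -
    have "qadjoint \<beta> \<beta> Y (mat 1) = ?p"
      using Y mat_1_in_qset unfolding proj_subset_def pset_proj_def by blast
    then show ?thesis
      using qadjoint_left_mult[OF p mat_1_in_qset left] by simp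
  qed
  ultimately show "is_projection ?p" by (simp add: is_projection_def)
qed

lemma proj_subset_left_mult:
  fixes \<beta> :: "'n::finite \<Rightarrow> 'b"
  assumes "p \<in> qset \<beta>" "is_projection p"
  shows "proj_subset \<beta> (\<lambda>a. p ** a)"
  using assms
  by (auto simp: proj_subset_def qlinear_def is_projection_def mult_in_qset matrix_add_ldistrib
      matrix_mult_mscale_right matrix_mul_assoc qadjoint_left_mult)

text \<open>
  Either side makes the projections pairwise orthogonal, the left by disjointness and the right as
  projections with sum \<open>1\<close>. The union of the parts then has their sum as its projection.
\<close>

lemma pset_partition_iff:
  fixes \<beta> :: "'n::finite \<Rightarrow> 'b"
  assumes P: "\<And>s. s \<in> {1..k} \<Longrightarrow> proj_subset \<beta> (P s)"
  shows "pset_partition \<beta> k P \<longleftrightarrow> (\<Sum>s\<in>{1..k}. pset_proj (P s)) = mat 1"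
proof -
  let ?p = "\<lambda>s. pset_proj (P s)"
  have proj: "is_projection (?p s)" if "s \<in> {1..k}" for s
    using proj_subset_proj[OF P[OF that]] by simp
  have disj: "pset_disjoint (P s) (P t) \<longleftrightarrow> ?p s ** ?p t = 0" if "s \<in> {1..k}" for s t
    using proj[OF that] by (simp add: pset_disjoint_def img_orthogonal_iff is_projection_def)
  have union: "pset_proj (pset_Union (P ` {1..k})) = (\<Sum>s\<in>{1..k}. ?p s)"
    if "\<And>s t. s \<in> {1..k} \<Longrightarrow> t \<in> {1..k} \<Longrightarrow> s \<noteq> t \<Longrightarrow> ?p s ** ?p t = 0"
    using projector_onto_span_orthogonal[of "{1..k}" ?p] proj that
    by (simp add: pset_proj_def[of "pset_Union _"] pset_Union_def)
  show ?thesis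
  proof
    assume *: "pset_partition \<beta> k P"
    then have "pset_proj (pset_Union (P ` {1..k})) = (\<Sum>s\<in>{1..k}. ?p s)"
      using disj by (intro union) (auto simp: pset_partition_def)
    then show "(\<Sum>s\<in>{1..k}. ?p s) = mat 1" using * by (simp add: pset_partition_def)
  next
    assume one: "(\<Sum>s\<in>{1..k}. ?p s) = mat 1"
    have orth: "?p s ** ?p t = 0" if "s \<in> {1..k}" "t \<in> {1..k}" "s \<noteq> t" for s t
      using projections_sum_1_orthogonal[of "{1..k}" ?p s t] proj one that by blast
    then show "pset_partition \<beta> k P"
      using P disj union one unfolding pset_partition_def by metis
  qed
qed

section \<open>Decompositions\<close>

lemma edges_disjoint_iff:
  fixes \<beta> :: "'n::finite \<Rightarrow> 'b"
  assumes "qlinear \<beta> \<beta> A" "proj_subset \<beta> Y" "proj_subset \<beta> Z"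
  shows "op_disjoint (edge_rel \<beta> A) (pset_times Y Z) \<longleftrightarrow>
    (\<forall>x\<in>qset \<beta>. pset_proj Z ** A (pset_proj Y ** x) = 0)"
  using proj_subset_proj[OF assms(2)] proj_subset_proj[OF assms(3)]
  by (simp add: op_disjoint_times_iff compressed_edge_action_eq_0_iff[OF assms(1)])

theorem theorem4p17:
  fixes \<beta> :: "'n::finite \<Rightarrow> 'b"
    and A :: "complex^'n^'n \<Rightarrow> complex^'n^'n"
    and k :: nat
  assumes "quantum_graph \<beta> A"
    and "undirected \<beta> A"
    and "loopless \<beta> A"
    and "k \<ge> 1"
  shows "component_decomposition \<beta> A k \<longleftrightarrow> cgw_decomposition \<beta> A k"
proof -
  have A: "qlinear \<beta> \<beta> A" using assms(1) by (simp add: quantum_graph_def)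
  show ?thesis
  proof
    assume "component_decomposition \<beta> A k"
    then obtain P where part: "pset_partition \<beta> k P"
      and nontriv: "\<forall>s\<in>{1..k}. nontrivial (pset_proj (P s))"
      and disj: "\<forall>s\<in>{1..k}. \<forall>t\<in>{1..k}. s \<noteq> t \<longrightarrow>
        op_disjoint (edge_rel \<beta> A) (pset_times (P s) (P t))"
      unfolding component_decomposition_def by (elim exE conjE)
    have sub: "proj_subset \<beta> (P s)" if "s \<in> {1..k}" for s
      using part that by (simp add: pset_partition_def)
    show "cgw_decomposition \<beta> A k"
      unfolding cgw_decomposition_def
    proof (intro exI[of _ "\<lambda>s. pset_proj (P s)"] conjI ballI impI)
      show "(\<Sum>s\<in>{1..k}. pset_proj (P s)) = mat 1"
        using part pset_partition_iff[OF sub] by simp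
    next
      fix s t x
      assume st: "s \<in> {1..k}" "t \<in> {1..k}" "s \<noteq> t" and x: "x \<in> qset \<beta>"
      have "op_disjoint (edge_rel \<beta> A) (pset_times (P t) (P s))"
        using disj st by simp
      then show "pset_proj (P s) ** A (pset_proj (P t) ** x) = 0"
        using edges_disjoint_iff[OF A sub[OF st(2)] sub[OF st(1)]] x by simp
    qed (use nontriv proj_subset_proj[OF sub] in auto)
  next
    assume "cgw_decomposition \<beta> A k"
    then obtain p where proj: "\<forall>s\<in>{1..k}. p s \<in> qset \<beta> \<and> is_projection (p s) \<and> nontrivial (p s)"
      and one: "(\<Sum>s\<in>{1..k}. p s) = mat 1"
      and adj: "\<forall>s\<in>{1..k}. \<forall>t\<in>{1..k}. s \<noteq> t \<longrightarrow> (\<forall>x\<in>qset \<beta>. p s ** A (p t ** x) = 0)"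
      unfolding cgw_decomposition_def by (elim exE conjE)
    define P :: "nat \<Rightarrow> complex^'n^'n \<Rightarrow> complex^'n^'n" where "P s a = p s ** a" for s a
    have P: "pset_proj (P s) = p s" for s
      by (simp add: P_def pset_proj_def)
    have sub: "proj_subset \<beta> (P s)" if "s \<in> {1..k}" for s
      unfolding P_def using proj that by (intro proj_subset_left_mult) auto
    show "component_decomposition \<beta> A k"
      unfolding component_decomposition_def
    proof (intro exI[of _ P] conjI ballI impI)
      show "pset_partition \<beta> k P"
        using pset_partition_iff[OF sub] one by (simp add: P)
    next
      fix s t
      assume st: "s \<in> {1..k}" "t \<in> {1..k}" "s \<noteq> t"
      then show "op_disjoint (edge_rel \<beta> A) (pset_times (P s) (P t))"
        using edges_disjoint_iff[OF A sub[OF st(1)] sub[OF st(2)]] adj by (simp add: P)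
    qed (use proj in \<open>simp add: P\<close>)
  qed
qed

end
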